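(* Let $k$ be an algebraically closed field of characteristic $0$, let $s_1,s_2\in k$ with $27-18s_1s_2-s_1^2s_2^2+4s_1^3+4s_2^3\neq 0$, and let $K=k(X,Y)$ be the genus $2$ field given by $Y^2=X^6-s_1X^4+s_2X^2-1$. Put $u=s_1s_2$ and $v=s_1^3+s_2^3$, and let $E_1=k(X^2,Y)$ and $E_2=k(X^2,XY)$ be its paired degree $2$ elliptic subfields. Then the $j$-invariants $j_1$ and $j_2$ of $E_1$ and $E_2$ are the roots of the quadratic $$j^2+256\,\frac{2u^3-54u^2+9uv-v^2+27v}{u^2+18u-4v-27}\,j+65536\,\frac{(u^2+9u-3v)^3}{(u^2+18u-4v-27)^2}=0 .$$
   Context: The $j$-invariant is normalized as usual, so that $y^2=x^3+x$ has $j=1728$. "Roots" are counted with multiplicity. *)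

theory Defs
  imports "HOL-Computational_Algebra.Computational_Algebra" "Subresultants.Resultant_Prelim"
begin

text \<open>
  Field extensions $K/k$ are rendered by two field types and a field homomorphism
  \<open>\<iota> :: 'k \<Rightarrow> 'K\<close>; intermediate fields are sets of elements of \<open>'K\<close>.
\<close>

definition is_subfield :: "'a::field set \<Rightarrow> bool" where
  "is_subfield F \<longleftrightarrow>
     0 \<in> F \<and> 1 \<in> F \<and>
     (\<forall>x\<in>F. \<forall>y\<in>F. x + y \<in> F \<and> x * y \<in> F) \<and>
     (\<forall>x\<in>F. - x \<in> F \<and> inverse x \<in> F)"

definition adjoin :: "('k::field \<Rightarrow> 'K::field) \<Rightarrow> 'K set \<Rightarrow> 'K set" where
  "adjoin \<iota> S = \<Inter>{F. is_subfield F \<and> range \<iota> \<subseteq> F \<and> S \<subseteq> F}"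

definition transcendental_over :: "('k::field \<Rightarrow> 'K::field) \<Rightarrow> 'K \<Rightarrow> bool" where
  "transcendental_over \<iota> x \<longleftrightarrow> (\<forall>p. poly (map_poly \<iota> p) x = 0 \<longrightarrow> p = 0)"

text \<open>
  \<open>E\<close> is the function field of the elliptic curve $y^2 = x^3 + ax + b$ over $k$.
  In characteristic 0 every elliptic function field over an algebraically closed
  field has such a short Weierstrass equation.
\<close>

definition has_weierstrass_equation ::
    "('k::field \<Rightarrow> 'K::field) \<Rightarrow> 'K set \<Rightarrow> 'k \<Rightarrow> 'k \<Rightarrow> bool" where
  "has_weierstrass_equation \<iota> E a b \<longleftrightarrow>
     4 * a ^ 3 + 27 * b ^ 2 \<noteq> 0 \<and>
     (\<exists>x y. transcendental_over \<iota> x \<and> y ^ 2 = x ^ 3 + \<iota> a * x + \<iota> b \<and> E = adjoin \<iota> {x, y})"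

text \<open>
  The description below leaves \<open>j_invariant \<iota> E\<close> unspecified unless \<open>E\<close> has a Weierstrass
  equation and all its Weierstrass equations give the same value.
\<close>

definition j_invariant :: "('k::field \<Rightarrow> 'K::field) \<Rightarrow> 'K set \<Rightarrow> 'k" where
  "j_invariant \<iota> E =
     (THE j. \<exists>a b. has_weierstrass_equation \<iota> E a b \<and>
                   j = 1728 * (4 * a ^ 3) / (4 * a ^ 3 + 27 * b ^ 2))"

end

(*
  The point is that the j-invariant of an elliptic function field F does not depend on the
  Weierstrass equation. Let F = k(x, y) = k(x', y') with y^2 = f(x) and y'^2 = f'(x'), where f and
  f' are squarefree cubics. If x' is not in k(x), then x and x' satisfy a relation P(x, x') = 0 of
  degree 2 in each variable. Completing the square with respect to x' gives an element of F whose
  square is the discriminant of P in k[x]; as it has degree at most 4 and f is squarefree, this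
  discriminant is a constant multiple of f. By symmetry the other discriminant is a multiple of f'.
  The two discriminants of a (2,2)-form have the same invariants I and J as binary quartics, and
  this forces the j-invariants to agree. If x' is in k(x), then x' is a Moebius transform of x, and
  I and J change only by powers of the determinant.
*)
theory Submission
  imports Defs
begin

hide_const (open) module.smult

section \<open>Polynomials over an algebraically closed field\<close>

text \<open>Each root \<open>r\<close> of \<open>q\<close> is at least a double root of
  \<open>p ^ 2 * f\<close>. As \<open>f\<close> has no double root, \<open>p\<close> vanishes at
  \<open>r\<close> as well, so \<open>X - r\<close> cancels from both \<open>q\<close> and
  \<open>p\<close> and induction on \<open>degree q\<close> applies.\<close>

lemma dvd_of_square_dvd:
  fixes p q f D :: "'k::alg_closed_field poly"
  assumes sqfree: "\<And>r. \<not> [:-r, 1:] ^ 2 dvd f"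
  shows "q \<noteq> 0 \<Longrightarrow> q ^ 2 * D = p ^ 2 * f \<Longrightarrow> q dvd p"
proof (induction "degree q" arbitrary: p q rule: less_induct)
  case less
  show ?case
  proof (cases "degree q = 0")
    case True
    with less.prems(1) show ?thesis
      by (meson is_unit_iff_degree unit_imp_dvd)
  next
    case False
    then obtain r where r: "poly q r = 0"
      using alg_closed_imp_poly_has_root[of q] by auto
    then obtain q' where q': "q = [:-r, 1:] * q'"
      by (auto simp: poly_eq_0_iff_dvd)
    have "poly p r = 0"
    proof (rule ccontr)
      assume p: "poly p r \<noteq> 0"
      have "f \<noteq> 0" using sqfree[of r] by auto
      then have "p ^ 2 * f \<noteq> 0" using p by auto
      moreover have "[:-r, 1:] ^ 2 dvd p ^ 2 * f"
        unfolding less.prems(2)[symmetric] q' by (simp only: power_mult_distrib mult.assoc dvd_triv_left)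
      ultimately have "2 \<le> order r (p ^ 2 * f)"
        by (simp add: order_divides)
      also have "order r (p ^ 2 * f) = order r f"
        using \<open>p ^ 2 * f \<noteq> 0\<close> p by (subst order_mult) (auto intro!: order_0I)
      finally have "[:-r, 1:] ^ 2 dvd f"
        by (simp add: order_divides)
      with sqfree show False by blast
    qed
    then obtain p' where p': "p = [:-r, 1:] * p'"
      by (auto simp: poly_eq_0_iff_dvd)
    have "[:-r, 1:] ^ 2 * (q' ^ 2 * D) = [:-r, 1:] ^ 2 * (p' ^ 2 * f)"
      using less.prems(2) unfolding q' p' by (simp only: power_mult_distrib mult.assoc)
    moreover have "[:-r, 1:] ^ 2 \<noteq> 0" by simp
    ultimately have "q' ^ 2 * D = p' ^ 2 * f"
      using mult_left_cancel by blast
    moreover have "q' \<noteq> 0" "degree q' < degree q"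
      using less.prems(1) unfolding q' by (auto simp: degree_mult_eq simp del: mult_pCons_left)
    ultimately have "q' dvd p'"
      using less.hyps by blast
    then show ?thesis unfolding q' p' by (rule mult_dvd_mono[OF dvd_refl])
  qed
qed

text \<open>With \<open>p = q * s\<close> the equation becomes \<open>D = s ^ 2 * f\<close>, of
  degree \<open>2 * degree s + 3\<close>. The bound 4 leaves only constant \<open>s\<close>.\<close>

lemma quartic_eq_smult_cubic:
  fixes p q f D :: "'k::alg_closed_field poly"
  assumes sqfree: "\<And>r. \<not> [:-r, 1:] ^ 2 dvd f"
    and "degree f = 3" "degree D \<le> 4" "q \<noteq> 0" "p \<noteq> 0"
    and eq: "q ^ 2 * D = p ^ 2 * f"
  obtains d where "d \<noteq> 0" "D = smult d f"
proof -
  obtain s where s: "p = q * s"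
    using dvd_of_square_dvd[OF sqfree \<open>q \<noteq> 0\<close> eq] by (blast elim: Rings.dvdE)
  have D: "D = s ^ 2 * f"
    using eq \<open>q \<noteq> 0\<close> by (simp add: s power_mult_distrib mult.assoc)
  have "s \<noteq> 0" "f \<noteq> 0"
    using s \<open>p \<noteq> 0\<close> \<open>degree f = 3\<close> by auto
  then have "degree D = 2 * degree s + 3"
    by (simp add: D degree_mult_eq degree_power_eq \<open>degree f = 3\<close>)
  with \<open>degree D \<le> 4\<close> have "degree s = 0" by simp
  then obtain e where e: "s = [:e:]" by (meson degree_eq_zeroE)
  show ?thesis
    by (rule that[of "e ^ 2"]) (use \<open>s \<noteq> 0\<close> in \<open>auto simp: D e power2_eq_square\<close>)
qed

text \<open>At a double root \<open>r\<close> both the cubic and its derivative vanish, so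
  \<open>a = - 3 r^2\<close> and \<open>b = 2 r^3\<close>, which makes \<open>4 a^3 + 27 b^2\<close>
  zero.\<close>

lemma no_square_factor_cubic:
  fixes a b :: "'k::field_char_0"
  assumes "4 * a ^ 3 + 27 * b ^ 2 \<noteq> 0"
  shows "\<not> [:-r, 1:] ^ 2 dvd [:b, a, 0, 1:]"
proof
  assume "[:-r, 1:] ^ 2 dvd [:b, a, 0, 1:]"
  then obtain g where g: "[:b, a, 0, 1:] = [:-r, 1:] ^ 2 * g"
    by (auto elim: Rings.dvdE)
  have "poly [:b, a, 0, 1:] r = 0"
    unfolding g by simp
  moreover have "poly (pderiv [:b, a, 0, 1:]) r = 0"
    unfolding g power2_eq_square pderiv_mult by (simp add: pderiv_pCons)
  ultimately have b: "b + r * (a + r * r) = 0" and "a + 3 * (r * r) = 0"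
    by (auto simp: pderiv_pCons algebra_simps)
  then have a: "a = - (3 * (r * r))"
    by (simp add: eq_neg_iff_add_eq_0)
  have "b - 2 * r ^ 3 = b + r * (a + r * r)"
    unfolding a by (simp add: algebra_simps power3_eq_cube)
  with b have "b = 2 * r ^ 3" by simp
  with a have "4 * a ^ 3 + 27 * b ^ 2 = 0"
    by (simp add: power2_eq_square power3_eq_cube)
  with assms show False by simp
qed

section \<open>Polynomials in two variables: specialization of the inner variable, Gauss's lemma,
  inner degree\<close>

definition fibre :: "'k::idom \<Rightarrow> 'k poly poly \<Rightarrow> 'k poly" where
  "fibre r = map_poly (\<lambda>c. poly c r)"

lemma fibre_mult: "fibre r (P * Q) = fibre r P * fibre r Q"
proof -
  interpret map_poly_comm_ring_hom "\<lambda>c. poly c r" ..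
  show ?thesis by (simp add: fibre_def hom_mult)
qed

lemma fibre_smult: "fibre r (smult d P) = smult (poly d r) (fibre r P)"
  by (simp add: fibre_def poly_eq_iff coeff_map_poly)

lemma fibre_eq_0E:
  assumes "fibre r P = 0"
  obtains P' where "P = smult [:-r, 1:] P'"
proof -
  have "poly (coeff P n) r = 0" for n
    using assms by (simp add: fibre_def poly_eq_iff coeff_map_poly)
  then have "[:[:-r, 1:]:] dvd P"
    unfolding const_poly_dvd_iff poly_eq_0_iff_dvd by blast
  then show ?thesis
    using that by (auto elim!: Rings.dvdE)
qed

text \<open>
  Gauss's lemma: over an algebraically closed field, a polynomial over \<open>k[X]\<close> is primitive iff
  no specialization of \<open>X\<close> makes it vanish.
\<close>
lemma dvd_cancel_smult_of_fibres:
  fixes P Q S :: "'k::alg_closed_field poly poly"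
  assumes fibres: "\<And>r. fibre r P \<noteq> 0"
  shows "d \<noteq> 0 \<Longrightarrow> smult d Q = P * S \<Longrightarrow> P dvd Q"
proof (induction "degree d" arbitrary: d S rule: less_induct)
  case less
  show ?case
  proof (cases "degree d = 0")
    case True
    then obtain c where c: "d = [:c:]" by (meson degree_eq_zeroE)
    then have "Q = smult [:1 / c:] (smult d Q)"
      using less.prems(1) by (simp flip: one_pCons)
    then have "Q = P * smult [:1 / c:] S"
      unfolding less.prems(2) by simp
    then show ?thesis by (rule dvdI)
  next
    case False
    then obtain r where r: "poly d r = 0"
      using alg_closed_imp_poly_has_root[of d] by auto
    then obtain d' where d': "d = [:-r, 1:] * d'"
      by (auto simp: poly_eq_0_iff_dvd)
    \<comment> \<open>Specialization at \<open>r\<close> is multiplicative and kills the left side.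
      As \<open>P\<close> survives it, \<open>S\<close> does not, so the factor \<open>X - r\<close>
      of \<open>d\<close> can be moved into \<open>S\<close> and cancelled.\<close>
    have "fibre r P * fibre r S = 0"
      using arg_cong[OF less.prems(2), of "fibre r"] r by (simp add: fibre_mult fibre_smult)
    with fibres obtain S' where S': "S = smult [:-r, 1:] S'"
      by (metis fibre_eq_0E mult_eq_0_iff)
    have "smult [:-r, 1:] (smult d' Q) = smult [:-r, 1:] (P * S')"
      using less.prems(2) unfolding d' S' by (simp add: mult_smult_right del: mult_pCons_left)
    then have "smult d' Q = P * S'"
      by (rule smult_cancel[rotated]) simp
    moreover have "d' \<noteq> 0" "degree d' < degree d"
      using less.prems(1) unfolding d' by (auto simp: degree_mult_eq simp del: mult_pCons_left)
    ultimately show ?thesis using less.hyps by blast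
  qed
qed

text \<open>This selects a leading monomial in lexicographic order: \<open>m\<close> is the degree
  in the inner variable, and \<open>i\<close> is the largest outer exponent at which that degree is
  attained.\<close>

lemma max_inner_degree:
  fixes P :: "'k::zero poly poly"
  assumes "P \<noteq> 0"
  obtains i m where "coeff (coeff P i) m \<noteq> 0" "\<And>n l. l > m \<Longrightarrow> coeff (coeff P n) l = 0"
    "\<And>n. n > i \<Longrightarrow> coeff (coeff P n) m = 0"
proof -
  define M where "M = {l. \<exists>n. coeff (coeff P n) l \<noteq> 0}"
  have "M \<subseteq> (\<Union>n\<le>degree P. {..degree (coeff P n)})"
    unfolding M_def by (auto intro!: le_degree simp: Bex_def) (metis coeff_0 le_degree)
  then have "finite M" by (rule finite_subset) auto
  moreover have "M \<noteq> {}"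
    using assms unfolding M_def by (auto simp: poly_eq_iff)
  ultimately have m: "Max M \<in> M" "\<And>l. l \<in> M \<Longrightarrow> l \<le> Max M" by auto
  define N where "N = {n. coeff (coeff P n) (Max M) \<noteq> 0}"
  have "N \<subseteq> {..degree P}"
    unfolding N_def by (auto intro!: le_degree)
  then have "finite N" by (rule finite_subset) auto
  moreover have "N \<noteq> {}"
    using m(1) unfolding M_def N_def by auto
  ultimately have n: "Max N \<in> N" "\<And>l. l \<in> N \<Longrightarrow> l \<le> Max N" by auto
  show ?thesis
  proof (rule that[of "Max N" "Max M"])
    show "coeff (coeff P (Max N)) (Max M) \<noteq> 0" using n(1) unfolding N_def by blast
    show "coeff (coeff P n) l = 0" if "l > Max M" for n l
      using m(2)[of l] that unfolding M_def by fastforce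
    show "coeff (coeff P k) (Max M) = 0" if "k > Max N" for k
      using n(2)[of k] that unfolding N_def by fastforce
  qed
qed

text \<open>Over a domain the degree in the inner variable is additive on products, because the
  leading monomials of the two factors multiply to a monomial that nothing else can cancel.\<close>

lemma inner_degree_le_of_dvd:
  fixes P Q :: "'k::idom poly poly"
  assumes "P dvd Q" "Q \<noteq> 0" and Q: "\<And>n. degree (coeff Q n) \<le> N"
  shows "degree (coeff P n) \<le> N"
proof -
  obtain S where S: "Q = P * S" using \<open>P dvd Q\<close> by (blast elim: Rings.dvdE)
  then have "P \<noteq> 0" "S \<noteq> 0" using \<open>Q \<noteq> 0\<close> by auto
  obtain i m where P: "coeff (coeff P i) m \<noteq> 0" "\<And>n l. l > m \<Longrightarrow> coeff (coeff P n) l = 0"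
    "\<And>n. n > i \<Longrightarrow> coeff (coeff P n) m = 0"
    using max_inner_degree[OF \<open>P \<noteq> 0\<close>] by blast
  obtain j k where S': "coeff (coeff S j) k \<noteq> 0" "\<And>n l. l > k \<Longrightarrow> coeff (coeff S n) l = 0"
    "\<And>n. n > j \<Longrightarrow> coeff (coeff S n) k = 0"
    using max_inner_degree[OF \<open>S \<noteq> 0\<close>] by blast
  \<comment> \<open>No inner degree exceeds \<open>m\<close> in \<open>P\<close> or \<open>k\<close>
    in \<open>S\<close>, so only the split \<open>m + k\<close> contributes.\<close>
  have inner: "coeff (coeff P s * coeff S t) (m + k) = coeff (coeff P s) m * coeff (coeff S t) k" for s t
  proof -
    have "coeff (coeff P s * coeff S t) (m + k)
        = (\<Sum>l\<le>m + k. coeff (coeff P s) l * coeff (coeff S t) (m + k - l))"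
      by (rule coeff_mult)
    also have "\<dots> = (\<Sum>l\<in>{m}. coeff (coeff P s) l * coeff (coeff S t) (m + k - l))"
    proof (rule sum.mono_neutral_right)
      show "\<forall>l\<in>{..m + k} - {m}. coeff (coeff P s) l * coeff (coeff S t) (m + k - l) = 0"
      proof
        fix l assume "l \<in> {..m + k} - {m}"
        then have "l > m \<or> m + k - l > k" by auto
        then show "coeff (coeff P s) l * coeff (coeff S t) (m + k - l) = 0"
          using P(2) S'(2) by auto
      qed
    qed auto
    finally show ?thesis by simp
  qed
  have "coeff (coeff Q (i + j)) (m + k)
      = (\<Sum>s\<le>i + j. coeff (coeff P s) m * coeff (coeff S (i + j - s)) k)"
    unfolding S coeff_mult[of P] by (simp add: coeff_sum inner)
  \<comment> \<open>At these top inner degrees the outer exponents are at most \<open>i\<close> and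
    \<open>j\<close>, so the exponent \<open>i + j\<close> arises only from that pair.\<close>
  also have "\<dots> = (\<Sum>s\<in>{i}. coeff (coeff P s) m * coeff (coeff S (i + j - s)) k)"
  proof (rule sum.mono_neutral_right)
    show "\<forall>s\<in>{..i + j} - {i}. coeff (coeff P s) m * coeff (coeff S (i + j - s)) k = 0"
    proof
      fix s assume "s \<in> {..i + j} - {i}"
      then have "s > i \<or> i + j - s > j" by auto
      then show "coeff (coeff P s) m * coeff (coeff S (i + j - s)) k = 0"
        using P(3) S'(3) by auto
    qed
  qed auto
  finally have "coeff (coeff Q (i + j)) (m + k) \<noteq> 0"
    using P(1) S'(1) by simp
  then have "m + k \<le> N"
    using Q[of "i + j"] le_degree order_trans by blast
  moreover have "degree (coeff P n) \<le> m"
    using P(2) by (intro degree_le) auto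
  ultimately show ?thesis by simp
qed

lemma poly_degree_le_1:
  assumes "degree p \<le> 1" obtains p0 p1 where "p = [:p0, p1:]"
proof
  show "p = [:coeff p 0, coeff p 1:]"
    using assms by (auto simp: poly_eq_iff coeff_pCons coeff_eq_0 split: nat.splits)
qed

lemma poly_degree_le_2:
  assumes "degree p \<le> 2" obtains p0 p1 p2 where "p = [:p0, p1, p2:]"
proof
  show "p = [:coeff p 0, coeff p 1, coeff p 2:]"
    using assms by (auto simp: poly_eq_iff coeff_pCons coeff_eq_0 eval_nat_numeral split: nat.splits)
qed

section \<open>Invariants of binary quartics\<close>

text \<open>The fundamental invariants of a binary quartic, normalized to have integral coefficients.\<close>
definition quartic_I :: "'a::comm_ring_1 poly \<Rightarrow> 'a" where
  "quartic_I p = 12 * coeff p 4 * coeff p 0 - 3 * coeff p 3 * coeff p 1 + coeff p 2 ^ 2"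

definition quartic_J :: "'a::comm_ring_1 poly \<Rightarrow> 'a" where
  "quartic_J p =
     72 * coeff p 4 * coeff p 2 * coeff p 0 + 9 * coeff p 3 * coeff p 2 * coeff p 1
     - 27 * coeff p 4 * coeff p 1 ^ 2 - 27 * coeff p 0 * coeff p 3 ^ 2 - 2 * coeff p 2 ^ 3"

lemma quartic_I_pCons: "quartic_I [:e0, e1, e2, e3, e4:] = 12 * e4 * e0 - 3 * e3 * e1 + e2 ^ 2"
  by (simp add: quartic_I_def coeff_pCons eval_nat_numeral)

lemma quartic_J_pCons: "quartic_J [:e0, e1, e2, e3, e4:] =
    72 * e4 * e2 * e0 + 9 * e3 * e2 * e1 - 27 * e4 * e1 ^ 2 - 27 * e0 * e3 ^ 2 - 2 * e2 ^ 3"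
  by (simp add: quartic_J_def coeff_pCons eval_nat_numeral)

lemma biquadratic_discriminant_expand:
  fixes a0 :: "'a::comm_ring_1"
  shows "[:b0, b1, b2:] ^ 2 - 4 * [:a0, a1, a2:] * [:c0, c1, c2:] =
    [:b0^2 - 4*a0*c0, 2*b0*b1 - 4*(a0*c1+a1*c0), b1^2+2*b0*b2-4*(a0*c2+a1*c1+a2*c0),
     2*b1*b2-4*(a1*c2+a2*c1), b2^2-4*a2*c2:]"
  by (simp add: numeral_poly power2_eq_square algebra_simps)

text \<open>
  Both sides are discriminants of the same polynomial of degree 2 in each of two variables,
  taken with respect to one variable and to the other.
\<close>
lemma quartic_I_biquadratic:
  fixes a0 :: "'a::comm_ring_1"
  shows "quartic_I ([:b0, b1, b2:] ^ 2 - 4 * [:a0, a1, a2:] * [:c0, c1, c2:])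
    = quartic_I ([:c1, b1, a1:] ^ 2 - 4 * [:c2, b2, a2:] * [:c0, b0, a0:])"
  unfolding biquadratic_discriminant_expand quartic_I_pCons
  by (simp add: algebra_simps power2_eq_square power3_eq_cube)

lemma quartic_J_biquadratic:
  fixes a0 :: "'a::comm_ring_1"
  shows "quartic_J ([:b0, b1, b2:] ^ 2 - 4 * [:a0, a1, a2:] * [:c0, c1, c2:])
    = quartic_J ([:c1, b1, a1:] ^ 2 - 4 * [:c2, b2, a2:] * [:c0, b0, a0:])"
  unfolding biquadratic_discriminant_expand quartic_J_pCons
  by (simp add: algebra_simps power2_eq_square power3_eq_cube)

text \<open>The value of the cubic \<open>t\<^sup>3 + a t + b\<close> at \<open>t = p / q\<close>, multiplied by \<open>q\<^sup>4\<close>.\<close>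
definition moebius_quartic :: "'a::comm_ring_1 \<Rightarrow> 'a \<Rightarrow> 'a poly \<Rightarrow> 'a poly \<Rightarrow> 'a poly" where
  "moebius_quartic a b p q = p ^ 3 * q + smult a (p * q ^ 3) + smult b (q ^ 4)"

lemma moebius_quartic_expand:
  fixes a :: "'a::comm_ring_1"
  shows "moebius_quartic a b [:p0, p1:] [:q0, q1:] =
    [:p0^3*q0 + a*p0*q0^3 + b*q0^4,
      3*p0^2*p1*q0 + p0^3*q1 + a*(p1*q0^3 + 3*p0*q0^2*q1) + 4*b*q0^3*q1,
      3*p0*p1^2*q0 + 3*p0^2*p1*q1 + a*(3*p1*q0^2*q1 + 3*p0*q0*q1^2) + 6*b*q0^2*q1^2,
      p1^3*q0 + 3*p0*p1^2*q1 + a*(3*p1*q0*q1^2 + p0*q1^3) + 4*b*q0*q1^3,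
      p1^3*q1 + a*p1*q1^3 + b*q1^4:]"
  by (simp add: moebius_quartic_def power2_eq_square power3_eq_cube power4_eq_xxxx algebra_simps)

text \<open>The binary form \<open>t^3 s + a t s^3 + b s^4\<close> has invariants
  \<open>- 3 a\<close> and \<open>- 27 b\<close>. Under a linear substitution I is multiplied by the
  fourth and J by the sixth power of the determinant, here \<open>p1 * q0 - p0 * q1\<close>.\<close>

lemma quartic_I_moebius:
  fixes a :: "'a::comm_ring_1"
  shows "quartic_I (moebius_quartic a b [:p0, p1:] [:q0, q1:]) = - 3 * a * (p1 * q0 - p0 * q1) ^ 4"
  unfolding moebius_quartic_expand quartic_I_pCons
  by (simp add: algebra_simps power2_eq_square power3_eq_cube power4_eq_xxxx)

lemma quartic_J_moebius:
  fixes a :: "'a::comm_ring_1"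
  shows "quartic_J (moebius_quartic a b [:p0, p1:] [:q0, q1:]) = - 27 * b * (p1 * q0 - p0 * q1) ^ 6"
proof -
  have six: "(p1 * q0 - p0 * q1) ^ 6 = (p1 * q0 - p0 * q1) ^ 3 * (p1 * q0 - p0 * q1) ^ 3"
    by (simp flip: power_add)
  show ?thesis
    unfolding six moebius_quartic_expand quartic_J_pCons
    by (simp add: algebra_simps power2_eq_square power3_eq_cube power4_eq_xxxx)
qed

text \<open>The cubic counts as a quartic with leading coefficient 0, that is, with a root at
  infinity. I and J are homogeneous of degrees 2 and 3 in the coefficients, whence the powers of
  \<open>d\<close>.\<close>

lemma quartic_I_cubic: "quartic_I (smult d [:b, a, 0, 1:]) = - 3 * d ^ 2 * (a::'a::comm_ring_1)"
  using quartic_I_pCons[of "d * b" "d * a" 0 d 0] by (simp add: power2_eq_square)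

lemma quartic_J_cubic: "quartic_J (smult d [:b, a, 0, 1:]) = - 27 * d ^ 3 * (b::'a::comm_ring_1)"
  using quartic_J_pCons[of "d * b" "d * a" 0 d 0] by (simp add: power2_eq_square power3_eq_cube)

section \<open>Quadratic extensions of rational function fields\<close>

lemma is_subfieldD:
  assumes "is_subfield F"
  shows "0 \<in> F" "1 \<in> F" "\<lbrakk>a \<in> F; b \<in> F\<rbrakk> \<Longrightarrow> a + b \<in> F" "\<lbrakk>a \<in> F; b \<in> F\<rbrakk> \<Longrightarrow> a * b \<in> F"
    "a \<in> F \<Longrightarrow> - a \<in> F" "\<lbrakk>a \<in> F; b \<in> F\<rbrakk> \<Longrightarrow> a - b \<in> F" "\<lbrakk>a \<in> F; b \<in> F\<rbrakk> \<Longrightarrow> a / b \<in> F"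
    "a \<in> F \<Longrightarrow> a ^ n \<in> F"
proof -
  show *: "0 \<in> F" "1 \<in> F" "\<lbrakk>a \<in> F; b \<in> F\<rbrakk> \<Longrightarrow> a + b \<in> F" "\<lbrakk>a \<in> F; b \<in> F\<rbrakk> \<Longrightarrow> a * b \<in> F"
    "a \<in> F \<Longrightarrow> - a \<in> F" for a b
    using assms by (auto simp: is_subfield_def)
  show "\<lbrakk>a \<in> F; b \<in> F\<rbrakk> \<Longrightarrow> a - b \<in> F"
    using *(3)[of a "- b"] *(5)[of b] by simp
  show "\<lbrakk>a \<in> F; b \<in> F\<rbrakk> \<Longrightarrow> a / b \<in> F"
    using assms by (auto simp: is_subfield_def divide_inverse)
  show "a \<in> F \<Longrightarrow> a ^ n \<in> F"
    by (induction n) (use * in auto)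
qed

lemma is_subfield_adjoin: "is_subfield (adjoin \<iota> S)"
  unfolding adjoin_def is_subfield_def by blast

lemma range_subset_adjoin: "range \<iota> \<subseteq> adjoin \<iota> S"
  unfolding adjoin_def by blast

lemma subset_adjoin: "S \<subseteq> adjoin \<iota> S"
  unfolding adjoin_def by blast

lemma adjoin_least: "is_subfield F \<Longrightarrow> range \<iota> \<subseteq> F \<Longrightarrow> S \<subseteq> F \<Longrightarrow> adjoin \<iota> S \<subseteq> F"
  unfolding adjoin_def by blast

lemmas adjoin_closed = is_subfieldD[OF is_subfield_adjoin]

lemma adjoin_scalar: "\<iota> c \<in> adjoin \<iota> S"
  using range_subset_adjoin by blast

lemma adjoin_gen: "s \<in> S \<Longrightarrow> s \<in> adjoin \<iota> S"
  using subset_adjoin by blast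

lemma adjoin_mono: "S \<subseteq> adjoin \<iota> T \<Longrightarrow> adjoin \<iota> S \<subseteq> adjoin \<iota> T"
  by (intro adjoin_least is_subfield_adjoin range_subset_adjoin)

lemma adjoin_eqI: "S \<subseteq> adjoin \<iota> T \<Longrightarrow> T \<subseteq> adjoin \<iota> S \<Longrightarrow> adjoin \<iota> S = adjoin \<iota> T"
  by (intro equalityI adjoin_mono)

locale field_extension = field_hom \<iota>
  for \<iota> :: "'k::{alg_closed_field, field_char_0} \<Rightarrow> 'K::field"
begin

definition ev :: "'K \<Rightarrow> 'k poly \<Rightarrow> 'K" where
  "ev x p = poly (map_poly \<iota> p) x"

sublocale ev: comm_ring_hom "ev x" for x
proof -
  interpret map: map_poly_comm_ring_hom \<iota> ..
  show "comm_ring_hom (ev x)"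
    by unfold_locales (simp_all add: ev_def hom_distribs)
qed

lemma ev_pCons [simp]: "ev x (pCons c p) = \<iota> c + x * ev x p"
  by (simp add: ev_def hom_distribs)

lemma ev_smult [simp]: "ev x (smult c p) = \<iota> c * ev x p"
  by (simp add: ev_def hom_distribs)

lemma ev_numeral [simp]: "ev x (numeral n) = numeral n"
  by (simp add: numeral_poly hom_distribs)

lemma ev_pcompose: "ev x (p \<circ>\<^sub>p q) = ev (ev x q) p"
  by (simp add: ev_def map_poly_pcompose poly_pcompose)

lemma ev_in_adjoin: "x \<in> adjoin \<iota> S \<Longrightarrow> ev x p \<in> adjoin \<iota> S"
  by (induction p) (auto intro!: adjoin_closed adjoin_scalar)

lemma transcendental_iff: "transcendental_over \<iota> x \<longleftrightarrow> (\<forall>p. ev x p = 0 \<longrightarrow> p = 0)"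
  by (simp add: transcendental_over_def ev_def)

text \<open>The quotients of polynomial values at \<open>x\<close> already form a subfield
  containing the constants and \<open>x\<close>, so minimality of \<open>adjoin\<close>
  applies.\<close>

lemma adjoin_singleton_fraction:
  assumes "z \<in> adjoin \<iota> {x}"
  obtains p q where "ev x q \<noteq> 0" "z = ev x p / ev x q"
proof -
  define F where "F = {ev x p / ev x q |p q. ev x q \<noteq> 0}"
  have I: "ev x p / ev x q \<in> F" if "ev x q \<noteq> 0" for p q
    using that unfolding F_def by blast
  have "is_subfield F"
    unfolding is_subfield_def
  proof (intro conjI ballI)
    show "0 \<in> F" "1 \<in> F" using I[of 1 0] I[of 1 1] by auto
  next
    fix a b assume "a \<in> F" "b \<in> F"
    then obtain p q r s where *: "ev x q \<noteq> 0" "a = ev x p / ev x q" "ev x s \<noteq> 0" "b = ev x r / ev x s"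
      unfolding F_def by blast
    have "a + b = ev x (p * s + r * q) / ev x (q * s)" "a * b = ev x (p * r) / ev x (q * s)"
      unfolding ev.hom_add ev.hom_mult *(2,4) using *(1,3) by (simp_all add: field_simps)
    moreover have "ev x (q * s) \<noteq> 0" using * by (simp add: ev.hom_mult)
    ultimately show "a + b \<in> F" "a * b \<in> F" by (simp_all only: I not_False_eq_True)
  next
    fix a assume "a \<in> F"
    then obtain p q where *: "ev x q \<noteq> 0" "a = ev x p / ev x q"
      unfolding F_def by blast
    then have "- a = ev x (- p) / ev x q" by (simp add: hom_distribs)
    then show "- a \<in> F" using I * by simp
    show "inverse a \<in> F"
    proof (cases "ev x p = 0")
      \<comment> \<open>Here \<open>a = 0\<close>, whose inverse is 0 by convention.\<close>
      case True then show ?thesis using * I[of 1 0] by simp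
    next
      case False then show ?thesis using I[OF False, of q] * by simp
    qed
  qed
  moreover have "range \<iota> \<subseteq> F"
    using I[of 1 "[:c:]" for c] by auto
  moreover have "{x} \<subseteq> F"
    using I[of 1 "[:0, 1:]"] by auto
  ultimately have "z \<in> F"
    using assms adjoin_least by blast
  then show ?thesis using that unfolding F_def by blast
qed

text \<open>The elements \<open>A + B * y\<close> form a subfield: products reduce by means of
  \<open>y ^ 2\<close>, and inverses come from multiplying by the conjugate
  \<open>A - B * y\<close>.\<close>

lemma adjoin_quadratic_decomp:
  assumes y2: "y ^ 2 \<in> adjoin \<iota> {x}" and z: "z \<in> adjoin \<iota> {x, y}"
  obtains A B where "A \<in> adjoin \<iota> {x}" "B \<in> adjoin \<iota> {x}" "z = A + B * y"
proof -
  let ?k = "adjoin \<iota> {x}"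
  define F where "F = {A + B * y |A B. A \<in> ?k \<and> B \<in> ?k}"
  have I: "A + B * y \<in> F" if "A \<in> ?k" "B \<in> ?k" for A B
    using that unfolding F_def by blast
  have k: "A \<in> F" if "A \<in> ?k" for A
    using I[OF that, of 0] by (simp add: adjoin_closed)
  have "is_subfield F"
    unfolding is_subfield_def
  proof (intro conjI ballI)
    show "0 \<in> F" "1 \<in> F" by (auto intro!: k adjoin_closed)
  next
    fix a b assume "a \<in> F" "b \<in> F"
    then obtain A B C D where *: "A \<in> ?k" "B \<in> ?k" "C \<in> ?k" "D \<in> ?k" "a = A + B * y" "b = C + D * y"
      unfolding F_def by blast
    then have "a + b = (A + C) + (B + D) * y" "a * b = (A * C + B * D * y ^ 2) + (A * D + B * C) * y"
      by (simp_all add: algebra_simps power2_eq_square)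
    then show "a + b \<in> F" "a * b \<in> F" using * y2 by (simp_all only: I adjoin_closed)
  next
    fix a assume "a \<in> F"
    then obtain A B where *: "A \<in> ?k" "B \<in> ?k" "a = A + B * y"
      unfolding F_def by blast
    have "- a = (- A) + (- B) * y" by (simp add: *)
    then show "- a \<in> F" using * by (simp only: I adjoin_closed)
    show "inverse a \<in> F"
    proof (cases "A - B * y = 0")
      \<comment> \<open>When the conjugate vanishes the norm cannot be inverted, but then
        \<open>a = 2 * A\<close> lies in the base field already.\<close>
      case True
      then have "a = 2 * A" using * by simp
      then have "inverse a = 1 / ((1 + 1) * A)" by (simp add: inverse_eq_divide)
      moreover have "1 / ((1 + 1) * A) \<in> ?k" using *(1) by (intro adjoin_closed)
      ultimately show ?thesis using k by simp
    next
      case False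
      define N where "N = A ^ 2 - B ^ 2 * y ^ 2"
      have N: "N = a * (A - B * y)" by (simp add: N_def * algebra_simps power2_eq_square)
      have "N \<in> ?k" using * y2 unfolding N_def by (simp only: adjoin_closed)
      moreover have "inverse a = A / N + (- B / N) * y"
      proof -
        have "A / N + (- B / N) * y = (A - B * y) / N" by (simp add: diff_divide_distrib)
        then show ?thesis using False unfolding N by (simp add: inverse_eq_divide)
      qed
      ultimately show ?thesis using *(1,2) by (simp only: I adjoin_closed)
    qed
  qed
  moreover have "range \<iota> \<subseteq> F"
    by (auto intro!: k adjoin_scalar)
  moreover have "y \<in> F"
    using I[OF adjoin_closed(1,2)] by simp
  then have "{x, y} \<subseteq> F"
    by (auto intro!: k adjoin_gen)
  ultimately have "z \<in> F"
    using z adjoin_least by blast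
  then show ?thesis using that unfolding F_def by blast
qed

text \<open>If \<open>y\<close> were a fraction \<open>p / q\<close>, transcendence of
  \<open>x\<close> would turn \<open>y ^ 2 = f\<close> into the polynomial identity
  \<open>p ^ 2 = f * q ^ 2\<close>, whose two sides have degrees of different parity.\<close>

lemma notin_adjoin_of_odd_degree:
  assumes x: "transcendental_over \<iota> x" and y: "y ^ 2 = ev x f" and f: "odd (degree f)"
  shows "y \<notin> adjoin \<iota> {x}"
proof
  assume "y \<in> adjoin \<iota> {x}"
  then obtain p q where q: "ev x q \<noteq> 0" "y = ev x p / ev x q"
    using adjoin_singleton_fraction by blast
  then have "ev x p ^ 2 = ev x f * ev x q ^ 2"
    using y[symmetric] by (simp add: power_divide)
  then have "ev x (p ^ 2 - f * q ^ 2) = 0"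
    by (simp add: ev.hom_minus ev.hom_mult ev.hom_power)
  then have eq: "p ^ 2 = f * q ^ 2"
    using x unfolding transcendental_iff by (metis right_minus_eq)
  have "f \<noteq> 0" "q \<noteq> 0" using f q by auto
  moreover from this have "p \<noteq> 0" using eq by auto
  ultimately have "2 * degree p = degree f + 2 * degree q"
    using arg_cong[OF eq, of degree] by (simp add: degree_mult_eq degree_power_eq)
  with f show False by presburger
qed

lemma two_neq_0: "(2 :: 'K) \<noteq> 0"
proof -
  have "\<iota> 2 \<noteq> 0" by (simp only: hom_0_iff) simp
  then show ?thesis by (metis hom_numeral)
qed

text \<open>For \<open>w = A + B * y\<close> the square contains the term
  \<open>2 * A * B * y\<close>. Since \<open>w ^ 2\<close> is in the base field and \<open>y\<close>
  is not, \<open>A * B = 0\<close>, and \<open>B = 0\<close> would put \<open>w\<close> into the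
  base field.\<close>

lemma square_in_base:
  assumes y: "y ^ 2 \<in> adjoin \<iota> {x}" "y \<notin> adjoin \<iota> {x}"
    and w: "w \<in> adjoin \<iota> {x, y}" "w ^ 2 \<in> adjoin \<iota> {x}" "w \<notin> adjoin \<iota> {x}"
  obtains B where "B \<in> adjoin \<iota> {x}" "w = B * y"
proof -
  obtain A B where AB: "A \<in> adjoin \<iota> {x}" "B \<in> adjoin \<iota> {x}" "w = A + B * y"
    using adjoin_quadratic_decomp y(1) w(1) by blast
  have "B \<noteq> 0" using AB w(3) by auto
  have "A = 0"
  proof (rule ccontr)
    assume "A \<noteq> 0"
    then have "y = (w ^ 2 - A ^ 2 - B ^ 2 * y ^ 2) / ((1 + 1) * A * B)"
      using \<open>B \<noteq> 0\<close> two_neq_0 unfolding AB(3) by (simp add: field_simps power2_eq_square)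
    also have "\<dots> \<in> adjoin \<iota> {x}"
      using AB(1,2) w(2) y(1) by (simp only: adjoin_closed)
    finally show False using y(2) by blast
  qed
  then show ?thesis using that AB by simp
qed

text \<open>Completing the square, \<open>w = 2 a z + b\<close> is a square root of the discriminant
  outside k(x), hence a multiple of \<open>y\<close> by an element of k(x). So discriminant and
  \<open>f\<close> agree up to squares, and the degree bounds reduce this to a constant.\<close>

lemma quadratic_discriminant:
  assumes x: "transcendental_over \<iota> x" and y: "y ^ 2 = ev x f"
    and f: "degree f = 3" "\<And>r. \<not> [:-r, 1:] ^ 2 dvd f"
    and z: "z \<in> adjoin \<iota> {x, y}" "z \<notin> adjoin \<iota> {x}"
    and rel: "ev x a * z ^ 2 + ev x b * z + ev x c = 0"
    and deg: "degree a \<le> 2" "degree b \<le> 2" "degree c \<le> 2"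
    and nz: "a \<noteq> 0 \<or> b \<noteq> 0 \<or> c \<noteq> 0"
  obtains d where "d \<noteq> 0" "b ^ 2 - 4 * a * c = smult d f"
proof -
  have ev0: "ev x p = 0 \<longleftrightarrow> p = 0" for p
    using x by (auto simp: transcendental_iff)
  have base: "ev x p \<in> adjoin \<iota> {x}" for p
    by (intro ev_in_adjoin adjoin_gen) simp
  \<comment> \<open>A relation of degree at most 1 would express \<open>z\<close> as a fraction in
    \<open>x\<close>.\<close>
  have "a \<noteq> 0"
  proof
    assume "a = 0"
    with rel have eq: "ev x b * z = - ev x c" by (simp add: eq_neg_iff_add_eq_0)
    then have "b \<noteq> 0" using nz \<open>a = 0\<close> by (auto simp: ev0)
    with eq have "z = - ev x c / ev x b" by (simp add: ev0 field_simps)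
    also have "\<dots> \<in> adjoin \<iota> {x}" by (intro adjoin_closed base)
    finally show False using z(2) by blast
  qed
  define w where "w = (1 + 1) * ev x a * z + ev x b"
  have w2: "w ^ 2 = ev x (b ^ 2 - 4 * a * c)"
  proof -
    have "w ^ 2 = 4 * ev x a * (ev x a * z ^ 2 + ev x b * z + ev x c) + (ev x b ^ 2 - 4 * ev x a * ev x c)"
      by (simp add: w_def algebra_simps power2_eq_square)
    then show ?thesis
      unfolding rel by (simp add: ev.hom_minus ev.hom_mult ev.hom_power)
  qed
  have "w \<notin> adjoin \<iota> {x}"
  proof
    assume w: "w \<in> adjoin \<iota> {x}"
    have "z = (w - ev x b) / ((1 + 1) * ev x a)"
      using \<open>a \<noteq> 0\<close> two_neq_0 by (simp add: w_def ev0)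
    also have "\<dots> \<in> adjoin \<iota> {x}" by (intro adjoin_closed base w)
    finally show False using z(2) by blast
  qed
  moreover have "w \<in> adjoin \<iota> {x, y}"
    unfolding w_def using z by (intro adjoin_closed ev_in_adjoin) (auto intro: adjoin_gen)
  moreover have "y \<notin> adjoin \<iota> {x}"
    using notin_adjoin_of_odd_degree[OF x y] f(1) by simp
  ultimately obtain B where B: "B \<in> adjoin \<iota> {x}" "w = B * y"
    using square_in_base[of y x w] base by (metis w2 y)
  obtain p q where pq: "ev x q \<noteq> 0" "B = ev x p / ev x q"
    using adjoin_singleton_fraction B(1) by blast
  \<comment> \<open>Squaring \<open>w = (p / q) * y\<close> and clearing denominators gives an
    identity of polynomials in \<open>x\<close>.\<close>
  have "ev x (q ^ 2 * (b ^ 2 - 4 * a * c)) = ev x q ^ 2 * w ^ 2"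
    by (simp only: ev.hom_mult ev.hom_power w2)
  also have "\<dots> = ev x p ^ 2 * y ^ 2"
    using pq by (simp add: B(2) power_mult_distrib power_divide)
  also have "\<dots> = ev x (p ^ 2 * f)"
    by (simp only: ev.hom_mult ev.hom_power y)
  finally have "ev x (q ^ 2 * (b ^ 2 - 4 * a * c) - p ^ 2 * f) = 0"
    by (simp only: ev.hom_minus diff_self)
  then have eq: "q ^ 2 * (b ^ 2 - 4 * a * c) = p ^ 2 * f"
    unfolding ev0 by simp
  have "p \<noteq> 0"
    using pq B(2) \<open>w \<notin> adjoin \<iota> {x}\<close> adjoin_closed(1) by fastforce
  moreover have "q \<noteq> 0" using pq by auto
  moreover have "degree (b ^ 2 - 4 * a * c) \<le> 4"
  proof (rule degree_diff_le)
    show "degree (b ^ 2) \<le> 4" using degree_power_le[of b 2] deg by simp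
    have "degree (a * c) \<le> 4" using degree_mult_le[of a c] deg by simp
    then show "degree (4 * a * c) \<le> 4"
      by (simp add: numeral_poly)
  qed
  ultimately show ?thesis
    using quartic_eq_smult_cubic[OF f(2) f(1) _ _ _ eq] that by blast
qed

lemma quadratic_relation:
  assumes y: "y ^ 2 = ev x f" and z: "z \<in> adjoin \<iota> {x, y}"
  obtains a b c where "a \<noteq> 0" "ev x a * z ^ 2 + ev x b * z + ev x c = 0"
proof -
  have "y ^ 2 \<in> adjoin \<iota> {x}"
    unfolding y by (intro ev_in_adjoin adjoin_gen) simp
  then obtain A B where AB: "A \<in> adjoin \<iota> {x}" "B \<in> adjoin \<iota> {x}" "z = A + B * y"
    using adjoin_quadratic_decomp z by blast
  obtain p q where pq: "ev x q \<noteq> 0" "A = ev x p / ev x q"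
    using adjoin_singleton_fraction AB(1) by blast
  obtain r s where rs: "ev x s \<noteq> 0" "B = ev x r / ev x s"
    using adjoin_singleton_fraction AB(2) by blast
  have "(z - A) ^ 2 = B ^ 2 * ev x f"
    by (simp add: AB(3) power_mult_distrib y)
  then have "ev x q ^ 2 * ev x s ^ 2 * (z - A) ^ 2 = ev x q ^ 2 * ev x s ^ 2 * (B ^ 2 * ev x f)"
    by simp
  moreover have "ev x q * A = ev x p" "ev x s * B = ev x r"
    using pq rs by auto
  moreover have "ev x q ^ 2 * ev x s ^ 2 * (z - A) ^ 2 = ev x s ^ 2 * (ev x q * z - ev x q * A) ^ 2"
    "ev x q ^ 2 * ev x s ^ 2 * (B ^ 2 * ev x f) = ev x q ^ 2 * (ev x s * B) ^ 2 * ev x f"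
    by (simp_all add: algebra_simps power2_eq_square)
  ultimately have eq: "ev x s ^ 2 * (ev x q * z - ev x p) ^ 2 = ev x q ^ 2 * ev x r ^ 2 * ev x f"
    by simp
  show ?thesis
  \<comment> \<open>These are the coefficients in \<open>z\<close> of
    \<open>s^2 (q z - p)^2 - q^2 r^2 f\<close>, obtained from \<open>(z - A)^2 = B^2 f\<close> by
    clearing denominators.\<close>
  proof (rule that[of "q ^ 2 * s ^ 2" "- 2 * p * q * s ^ 2" "p ^ 2 * s ^ 2 - q ^ 2 * r ^ 2 * f"])
    show "q ^ 2 * s ^ 2 \<noteq> 0" using pq rs by auto
    show "ev x (q ^ 2 * s ^ 2) * z ^ 2 + ev x (- 2 * p * q * s ^ 2) * z
        + ev x (p ^ 2 * s ^ 2 - q ^ 2 * r ^ 2 * f) = 0"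
      using eq by (simp add: ev.hom_minus ev.hom_mult ev.hom_power ev.hom_uminus algebra_simps power2_eq_square)
  qed
qed

section \<open>Relations between two elements, with inner variable \<open>x\<close> and outer
  variable \<open>z\<close>\<close>

definition ev2 :: "'K \<Rightarrow> 'K \<Rightarrow> 'k poly poly \<Rightarrow> 'K" where
  "ev2 x z P = poly (map_poly (ev x) P) z"

lemma ev2_hom: "comm_ring_hom (ev2 x z)"
proof -
  interpret map: map_poly_comm_ring_hom "ev x" ..
  show ?thesis
    by unfold_locales (simp_all add: ev2_def map.hom_add map.hom_mult)
qed

lemma ev2_0 [simp]: "ev2 x z 0 = 0"
  by (simp add: ev2_def)

lemma ev2_pCons [simp]: "ev2 x z (pCons c P) = ev x c + z * ev2 x z P"
  by (simp add: ev2_def ev.map_poly_pCons_hom)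

lemma ev2_smult: "ev2 x z (smult d P) = ev x d * ev2 x z P"
  by (simp add: ev2_def ev.map_poly_hom_smult)

lemma ev2_map_const: "ev2 x z (map_poly (\<lambda>t. [:t:]) q) = ev z q"
  by (simp add: ev2_def ev_def map_poly_map_poly o_def hom_distribs)

text \<open>A relation of least degree in \<open>z\<close>, chosen primitive over k[x], divides
  every other relation by Gauss's lemma. It therefore also inherits the bound on the degree in
  \<open>x\<close> from \<open>Q\<close>, so that both degrees are controlled at once.\<close>

lemma minimal_relation:
  assumes x: "transcendental_over \<iota> x"
    and Q: "Q \<noteq> 0" "ev2 x z Q = 0" "\<And>n. degree (coeff Q n) \<le> N"
  obtains P where "P \<noteq> 0" "ev2 x z P = 0" "\<And>n. degree (coeff P n) \<le> N"
    "\<And>R. R \<noteq> 0 \<Longrightarrow> ev2 x z R = 0 \<Longrightarrow> degree P \<le> degree R"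
proof -
  interpret e: comm_ring_hom "ev2 x z" by (rule ev2_hom)
  let ?R = "\<lambda>P. P \<noteq> 0 \<and> ev2 x z P = 0"
  obtain P0 where P0: "?R P0" "\<And>R. ?R R \<Longrightarrow> degree P0 \<le> degree R"
    using ex_has_least_nat[of ?R Q degree] Q by blast
  let ?S = "\<lambda>P. ?R P \<and> degree P = degree P0"
  \<comment> \<open>The second minimization, over the degree of the leading coefficient, forces
    primitivity: a common factor \<open>X - r\<close> of the coefficients could be divided
    out.\<close>
  obtain P where P: "?S P" "\<And>R. ?S R \<Longrightarrow> degree (lead_coeff P) \<le> degree (lead_coeff R)"
    using ex_has_least_nat[of ?S P0 "\<lambda>P. degree (lead_coeff P)"] P0(1) by blast
  have min: "degree P \<le> degree R" if "R \<noteq> 0" "ev2 x z R = 0" for R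
    using P(1) P0(2)[of R] that by simp
  have fibres: "fibre r P \<noteq> 0" for r
  proof
    assume "fibre r P = 0"
    then obtain P' where P': "P = smult [:-r, 1:] P'"
      using fibre_eq_0E by blast
    have "ev x [:-r, 1:] \<noteq> 0"
      using x unfolding transcendental_iff by (metis pCons_eq_0_iff zero_neq_one)
    then have "?S P'"
      using P(1) unfolding P' ev2_smult by simp
    moreover from this have "lead_coeff P' \<noteq> 0" using leading_coeff_0_iff by blast
    then have "degree (lead_coeff P') < degree (lead_coeff P)"
      unfolding P' lead_coeff_smult by (subst degree_mult_eq) auto
    ultimately show False using P(2)[of P'] by simp
  qed
  \<comment> \<open>The pseudo-remainder is again a relation between \<open>x\<close> and
    \<open>z\<close>, and it is zero or of smaller degree than \<open>P\<close>; by minimality it is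
    zero.\<close>
  obtain d S where dS: "d \<noteq> 0" "smult d Q = P * S + pseudo_mod Q P"
    using pseudo_mod(1)[of P Q] P(1) by blast
  have "ev2 x z (pseudo_mod Q P) = ev2 x z (smult d Q) - ev2 x z P * ev2 x z S"
    unfolding dS(2) e.hom_add e.hom_mult by simp
  also have "\<dots> = 0" using P(1) Q(2) by (simp add: ev2_smult)
  finally have "pseudo_mod Q P = 0"
    using pseudo_mod(2)[of P Q] P(1) min[of "pseudo_mod Q P"] by (meson not_less)
  then have "P dvd Q"
    using dvd_cancel_smult_of_fibres[OF fibres dS(1)] dS(2) by simp
  then have "degree (coeff P n) \<le> N" for n
    using inner_degree_le_of_dvd Q by blast
  then show ?thesis using that P(1) min by blast
qed

text \<open>Write \<open>x' = A + B * y\<close> over k(x), which lies in k(x'). If \<open>B\<close>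
  were nonzero, \<open>y\<close> and hence the whole field would lie in k(x'), contrary to the
  choice of \<open>y'\<close>.\<close>

lemma mem_adjoin_singleton_swap:
  assumes gen: "adjoin \<iota> {x, y} = adjoin \<iota> {x', y'}"
    and y: "y ^ 2 \<in> adjoin \<iota> {x}" and y': "y' \<notin> adjoin \<iota> {x'}"
    and x: "x \<in> adjoin \<iota> {x'}"
  shows "x' \<in> adjoin \<iota> {x}"
proof -
  have "x' \<in> adjoin \<iota> {x, y}"
    unfolding gen by (intro adjoin_gen) simp
  then obtain A B where AB: "A \<in> adjoin \<iota> {x}" "B \<in> adjoin \<iota> {x}" "x' = A + B * y"
    using adjoin_quadratic_decomp y by blast
  have sub: "adjoin \<iota> {x} \<subseteq> adjoin \<iota> {x'}"
    by (intro adjoin_mono) (use x in auto)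
  have x': "x' \<in> adjoin \<iota> {x'}"
    by (intro adjoin_gen) simp
  have "B = 0"
  proof (rule ccontr)
    assume "B \<noteq> 0"
    then have "y = (x' - A) / B" by (simp add: AB(3))
    also have "\<dots> \<in> adjoin \<iota> {x'}"
      using AB(1,2) sub x' by (intro adjoin_closed) auto
    finally have "adjoin \<iota> {x, y} \<subseteq> adjoin \<iota> {x'}"
      using x by (intro adjoin_mono) auto
    moreover have "y' \<in> adjoin \<iota> {x', y'}"
      by (intro adjoin_gen) simp
    ultimately show False using gen y' by blast
  qed
  then show ?thesis using AB by simp
qed

text \<open>A relation of degree at most 2 in \<open>x\<close> over k[z] is reread as a polynomial
  in \<open>z\<close> over k[x]; the old degree in \<open>x\<close> becomes the bound on the inner
  degree.\<close>

lemma relation_swap: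
  assumes "q0 \<noteq> 0 \<or> q1 \<noteq> 0 \<or> q2 \<noteq> 0"
    and "ev z q0 + x * ev z q1 + x ^ 2 * ev z q2 = 0"
    and "q2 = 0 \<or> N \<ge> 2" "N \<ge> 1"
  obtains Q where "Q \<noteq> 0" "ev2 x z Q = 0" "\<And>n. degree (coeff Q n) \<le> N"
proof -
  interpret e: comm_ring_hom "ev2 x z" by (rule ev2_hom)
  let ?c = "map_poly (\<lambda>t. [:t:]) :: 'k poly \<Rightarrow> 'k poly poly"
  define Q where "Q = ?c q0 + (smult [:0, 1:] (?c q1) + smult [:0, 0, 1:] (?c q2))"
  have coeff: "coeff Q n = [:coeff q0 n, coeff q1 n, coeff q2 n:]" for n
    by (simp add: Q_def coeff_map_poly)
  show ?thesis
  proof (rule that[of Q])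
    show "Q \<noteq> 0" using assms(1) by (auto simp: poly_eq_iff[of Q] poly_eq_iff[of q0]
          poly_eq_iff[of q1] poly_eq_iff[of q2] coeff)
    show "ev2 x z Q = 0"
      using assms(2) unfolding Q_def e.hom_add ev2_smult ev2_map_const
      by (simp add: algebra_simps power2_eq_square)
    show "degree (coeff Q n) \<le> N" for n
      using assms(3,4) by (auto simp: coeff split: if_splits)
  qed
qed

section \<open>Independence of the Weierstrass equation\<close>

lemma weierstrass_scaling_generic:
  assumes x: "transcendental_over \<iota> x" and y: "y ^ 2 = ev x [:b, a, 0, 1:]"
    and x': "transcendental_over \<iota> x'" and y': "y' ^ 2 = ev x' [:b', a', 0, 1:]"
    and ns: "4 * a ^ 3 + 27 * b ^ 2 \<noteq> 0" "4 * a' ^ 3 + 27 * b' ^ 2 \<noteq> 0"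
    and gen: "adjoin \<iota> {x, y} = adjoin \<iota> {x', y'}"
    and notin: "x' \<notin> adjoin \<iota> {x}" "x \<notin> adjoin \<iota> {x'}"
  obtains c d where "c \<noteq> 0" "d \<noteq> 0" "c ^ 2 * a = d ^ 2 * a'" "c ^ 3 * b = d ^ 3 * b'"
proof -
  have mem: "x' \<in> adjoin \<iota> {x, y}" "x \<in> adjoin \<iota> {x', y'}"
    using adjoin_gen[of x' "{x', y'}" \<iota>] adjoin_gen[of x "{x, y}" \<iota>] gen by auto
  \<comment> \<open>The relation that is quadratic in \<open>x\<close> bounds the inner degree of
    the minimal relation \<open>P\<close>; the one that is quadratic in \<open>x'\<close>, found
    below, bounds its outer degree.\<close>
  obtain r2 r1 r0 where r: "r2 \<noteq> 0" "ev x' r2 * x ^ 2 + ev x' r1 * x + ev x' r0 = 0"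
    using quadratic_relation[OF y' mem(2)] .
  obtain Q where Q: "Q \<noteq> 0" "ev2 x x' Q = 0" "\<And>n. degree (coeff Q n) \<le> 2"
    using relation_swap[of r0 r1 r2 x' x 2] r by (auto simp: algebra_simps)
  obtain P where P: "P \<noteq> 0" "ev2 x x' P = 0" "\<And>n. degree (coeff P n) \<le> 2"
      "\<And>R. R \<noteq> 0 \<Longrightarrow> ev2 x x' R = 0 \<Longrightarrow> degree P \<le> degree R"
    using minimal_relation[OF x Q] by blast
  obtain s2 s1 s0 where s: "s2 \<noteq> 0" "ev x s2 * x' ^ 2 + ev x s1 * x' + ev x s0 = 0"
    using quadratic_relation[OF y mem(1)] .
  have "degree P \<le> degree [:s0, s1, s2:]"
    using s by (intro P(4)) (auto simp: algebra_simps power2_eq_square)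
  also have "\<dots> \<le> 2" by simp
  finally obtain A0 A1 A2 where A: "P = [:A0, A1, A2:]"
    by (rule poly_degree_le_2)
  have "degree A0 \<le> 2" "degree A1 \<le> 2" "degree A2 \<le> 2"
    using P(3)[of 0] P(3)[of 1] P(3)[of 2] unfolding A by (simp_all add: eval_nat_numeral)
  then obtain a0 a1 a2 b0 b1 b2 c0 c1 c2
    where a: "A2 = [:a0, a1, a2:]" and b: "A1 = [:b0, b1, b2:]" and c: "A0 = [:c0, c1, c2:]"
    by (metis poly_degree_le_2)
  have rel: "ev x [:a0, a1, a2:] * x' ^ 2 + ev x [:b0, b1, b2:] * x' + ev x [:c0, c1, c2:] = 0"
    using P(2) unfolding A a b c by (simp add: algebra_simps power2_eq_square)
  \<comment> \<open>The same nine coefficients, with the matrix transposed: the relation is now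
    sorted by powers of \<open>x\<close>.\<close>
  then have rel': "ev x' [:c2, b2, a2:] * x ^ 2 + ev x' [:c1, b1, a1:] * x + ev x' [:c0, b0, a0:] = 0"
    by (simp add: algebra_simps power2_eq_square)
  have nz: "[:a0, a1, a2:] \<noteq> 0 \<or> [:b0, b1, b2:] \<noteq> 0 \<or> [:c0, c1, c2:] \<noteq> 0"
    using P(1) unfolding A a b c by auto
  then have nz': "[:c2, b2, a2:] \<noteq> 0 \<or> [:c1, b1, a1:] \<noteq> 0 \<or> [:c0, b0, a0:] \<noteq> 0"
    by auto
  have deg: "degree [:t0, t1, t2:] \<le> 2" "degree [:t, t', 0, 1 :: 'k:] = 3" for t0 t1 t2 t t' :: 'k
    by (simp_all add: eval_nat_numeral)
  obtain d where d: "d \<noteq> 0"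
      "[:b0, b1, b2:] ^ 2 - 4 * [:a0, a1, a2:] * [:c0, c1, c2:] = smult d [:b, a, 0, 1:]"
    using quadratic_discriminant[OF x y deg(2) no_square_factor_cubic[OF ns(1)] mem(1) notin(1) rel
        deg(1) deg(1) deg(1) nz] .
  obtain d' where d': "d' \<noteq> 0"
      "[:c1, b1, a1:] ^ 2 - 4 * [:c2, b2, a2:] * [:c0, b0, a0:] = smult d' [:b', a', 0, 1:]"
    using quadratic_discriminant[OF x' y' deg(2) no_square_factor_cubic[OF ns(2)] mem(2) notin(2) rel'
        deg(1) deg(1) deg(1) nz'] .
  have "- 3 * d ^ 2 * a = - 3 * d' ^ 2 * a'"
    using quartic_I_biquadratic[of b0 b1 b2 a0 a1 a2 c0 c1 c2]
    unfolding d(2) d'(2) quartic_I_cubic .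
  moreover have "- 27 * d ^ 3 * b = - 27 * d' ^ 3 * b'"
    using quartic_J_biquadratic[of b0 b1 b2 a0 a1 a2 c0 c1 c2]
    unfolding d(2) d'(2) quartic_J_cubic .
  ultimately show ?thesis
    using that[OF d(1) d'(1)] by simp
qed

text \<open>Here k(x) = k(x'), so the minimal relation has degree at most 1 in each variable and
  \<open>x'\<close> is a Moebius transform of \<open>x\<close>. Substituting it into the second
  cubic and clearing denominators gives a quartic proportional to the first cubic.\<close>

lemma weierstrass_scaling_moebius:
  assumes x: "transcendental_over \<iota> x" and y: "y ^ 2 = ev x [:b, a, 0, 1:]"
    and x': "transcendental_over \<iota> x'" and y': "y' ^ 2 = ev x' [:b', a', 0, 1:]"
    and ns: "4 * a ^ 3 + 27 * b ^ 2 \<noteq> 0"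
    and gen: "adjoin \<iota> {x, y} = adjoin \<iota> {x', y'}"
    and mem: "x' \<in> adjoin \<iota> {x}" "x \<in> adjoin \<iota> {x'}"
  obtains c d where "c \<noteq> 0" "d \<noteq> 0" "c ^ 2 * a = d ^ 2 * a'" "c ^ 3 * b = d ^ 3 * b'"
proof -
  have ev0: "ev x p = 0 \<longleftrightarrow> p = 0" for p
    using x by (auto simp: transcendental_iff)
  obtain r q where rq: "ev x' q \<noteq> 0" "x = ev x' r / ev x' q"
    using adjoin_singleton_fraction[OF mem(2)] .
  obtain Q where Q: "Q \<noteq> 0" "ev2 x x' Q = 0" "\<And>n. degree (coeff Q n) \<le> 1"
  proof (rule relation_swap[of "- r" q 0 x' x 1])
    show "- r \<noteq> 0 \<or> q \<noteq> 0 \<or> 0 \<noteq> (0 :: 'k poly)" using rq by auto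
    show "ev x' (- r) + x * ev x' q + x ^ 2 * ev x' 0 = 0"
      using rq by (simp add: ev.hom_uminus)
  qed auto
  obtain P where P: "P \<noteq> 0" "ev2 x x' P = 0" "\<And>n. degree (coeff P n) \<le> 1"
      "\<And>R. R \<noteq> 0 \<Longrightarrow> ev2 x x' R = 0 \<Longrightarrow> degree P \<le> degree R"
    using minimal_relation[OF x Q] by blast
  obtain s t where st: "ev x t \<noteq> 0" "x' = ev x s / ev x t"
    using adjoin_singleton_fraction[OF mem(1)] .
  have "degree P \<le> degree [:- s, t:]"
    using st by (intro P(4)) (auto simp: ev.hom_uminus)
  also have "\<dots> \<le> 1" by simp
  finally obtain A0 A1 where A: "P = [:A0, A1:]"
    by (rule poly_degree_le_1)
  have "degree A0 \<le> 1" "degree A1 \<le> 1"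
    using P(3)[of 0] P(3)[of 1] unfolding A by simp_all
  then obtain p0 p1 q0 q1 where p: "A0 = [:p0, p1:]" and q: "A1 = [:q0, q1:]"
    by (metis poly_degree_le_1)
  have rel: "ev x A1 * x' = ev x (- A0)"
    using P(2) unfolding A by (simp add: ev.hom_uminus eq_neg_iff_add_eq_0 algebra_simps)
  have "A1 \<noteq> 0"
    using P(1) rel unfolding A by (auto simp: ev.hom_uminus ev0)
  then have h: "ev x A1 \<noteq> 0" by (simp add: ev0)

  have y2: "y ^ 2 \<in> adjoin \<iota> {x}"
    unfolding y by (intro ev_in_adjoin adjoin_gen) simp
  have ynot: "y \<notin> adjoin \<iota> {x}"
    by (rule notin_adjoin_of_odd_degree[OF x y]) simp
  have "y' ^ 2 \<in> adjoin \<iota> {x}"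
    unfolding y' by (intro ev_in_adjoin mem)
  moreover have "y' \<in> adjoin \<iota> {x, y}"
    unfolding gen by (intro adjoin_gen) simp
  moreover have y'not: "y' \<notin> adjoin \<iota> {x}"
  proof
    assume "y' \<in> adjoin \<iota> {x}"
    then have "adjoin \<iota> {x, y} \<subseteq> adjoin \<iota> {x}"
      unfolding gen using mem(1) by (intro adjoin_mono) auto
    moreover have "y \<in> adjoin \<iota> {x, y}" by (intro adjoin_gen) simp
    ultimately show False using ynot by blast
  qed
  ultimately obtain B where B: "B \<in> adjoin \<iota> {x}" "y' = B * y"
    using square_in_base[OF y2 ynot] by blast
  obtain u v where uv: "ev x v \<noteq> 0" "B = ev x u / ev x v"
    using adjoin_singleton_fraction B(1) by blast
  define G where "G = moebius_quartic a' b' (- A0) A1"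
  \<comment> \<open>\<open>G\<close> is the second cubic at \<open>x' = - A0 / A1\<close>,
    multiplied by \<open>A1 ^ 4\<close>.\<close>
  have "ev x G = ev x A1 ^ 4 * y' ^ 2"
    unfolding G_def moebius_quartic_def y' ev.hom_add ev.hom_mult ev.hom_power ev_smult rel[symmetric]
    by (simp add: algebra_simps eval_nat_numeral)
  then have "ev x (v ^ 2 * G) = ev x A1 ^ 4 * ((ev x v * B) ^ 2 * y ^ 2)"
    by (simp add: ev.hom_mult ev.hom_power B(2) power_mult_distrib)
  also have "ev x v * B = ev x u" using uv by simp
  also have "ev x A1 ^ 4 * (ev x u ^ 2 * y ^ 2) = ev x ((A1 ^ 2 * u) ^ 2 * [:b, a, 0, 1:])"
    unfolding y ev.hom_mult ev.hom_power power_mult_distrib by (simp flip: power_mult)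
  finally have "ev x (v ^ 2 * G - (A1 ^ 2 * u) ^ 2 * [:b, a, 0, 1:]) = 0"
    by (simp only: ev.hom_minus diff_self)
  then have eq: "v ^ 2 * G = (A1 ^ 2 * u) ^ 2 * [:b, a, 0, 1:]"
    unfolding ev0 by simp
  have "u \<noteq> 0"
    using uv B(2) y'not adjoin_closed(1) by fastforce
  then have nz: "v \<noteq> 0" "A1 ^ 2 * u \<noteq> 0" using uv \<open>A1 \<noteq> 0\<close> by auto
  have G: "G = moebius_quartic a' b' [:- p0, - p1:] [:q0, q1:]"
    by (simp add: G_def p q)
  have "degree G \<le> 4"
    unfolding G moebius_quartic_expand by simp
  then obtain d where d: "d \<noteq> 0" "G = smult d [:b, a, 0, 1:]"
    using quartic_eq_smult_cubic[OF no_square_factor_cubic[OF ns] _ _ nz eq] by auto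
  define \<Delta> where "\<Delta> = - p1 * q0 + p0 * q1"
  have I: "- 3 * d ^ 2 * a = - 3 * a' * \<Delta> ^ 4"
    using quartic_I_moebius[of a' b' "- p0" "- p1" q0 q1]
    unfolding G[symmetric] unfolding d(2) quartic_I_cubic \<Delta>_def by simp
  have J: "- 27 * d ^ 3 * b = - 27 * b' * \<Delta> ^ 6"
    using quartic_J_moebius[of a' b' "- p0" "- p1" q0 q1]
    unfolding G[symmetric] unfolding d(2) quartic_J_cubic \<Delta>_def by simp
  \<comment> \<open>A vanishing determinant would give \<open>a = b = 0\<close>, against
    nonsingularity.\<close>
  have "\<Delta> \<noteq> 0"
    using I J d(1) ns by auto
  \<comment> \<open>The weights 4 and 6 are twice 2 and 3, so \<open>\<Delta> ^ 2\<close> serves as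
    the second scaling factor.\<close>
  moreover have "d ^ 2 * a = (\<Delta> ^ 2) ^ 2 * a'" "d ^ 3 * b = (\<Delta> ^ 2) ^ 3 * b'"
    using I J by (simp_all add: mult.commute flip: power_mult)
  ultimately show ?thesis using that[of d "\<Delta> ^ 2"] d(1) by simp
qed

text \<open>The cube of the first and the square of the second scaling relation both carry the
  factors \<open>c ^ 6\<close> and \<open>d ^ 6\<close>, which cancel in the homogeneous
  quotient.\<close>

lemma j_eq_of_scaling:
  fixes a b a' b' c d :: "'a::field"
  assumes "c \<noteq> 0" "d \<noteq> 0" "c ^ 2 * a = d ^ 2 * a'" "c ^ 3 * b = d ^ 3 * b'"
  shows "1728 * (4 * a ^ 3) / (4 * a ^ 3 + 27 * b ^ 2) = 1728 * (4 * a' ^ 3) / (4 * a' ^ 3 + 27 * b' ^ 2)"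
proof -
  have a: "c ^ 6 * a ^ 3 = d ^ 6 * a' ^ 3"
    using arg_cong[OF assms(3), of "\<lambda>t. t ^ 3"] by (simp add: power_mult_distrib flip: power_mult)
  have b: "c ^ 6 * b ^ 2 = d ^ 6 * b' ^ 2"
    using arg_cong[OF assms(4), of "\<lambda>t. t ^ 2"] by (simp add: power_mult_distrib flip: power_mult)
  have "1728 * (4 * a ^ 3) / (4 * a ^ 3 + 27 * b ^ 2)
      = 1728 * (4 * (c ^ 6 * a ^ 3)) / (4 * (c ^ 6 * a ^ 3) + 27 * (c ^ 6 * b ^ 2))"
    using assms(1) by (simp add: mult.left_commute[of _ "c ^ 6"] flip: distrib_left)
  also have "\<dots> = 1728 * (4 * a' ^ 3) / (4 * a' ^ 3 + 27 * b' ^ 2)"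
    unfolding a b using assms(2) by (simp add: mult.left_commute[of _ "d ^ 6"] flip: distrib_left)
  finally show ?thesis .
qed

lemma j_invariant_eqI:
  assumes W: "has_weierstrass_equation \<iota> E a b"
  shows "j_invariant \<iota> E = 1728 * (4 * a ^ 3) / (4 * a ^ 3 + 27 * b ^ 2)"
  unfolding j_invariant_def
proof (rule the_equality)
  show "\<exists>a' b'. has_weierstrass_equation \<iota> E a' b' \<and>
      1728 * (4 * a ^ 3) / (4 * a ^ 3 + 27 * b ^ 2) = 1728 * (4 * a' ^ 3) / (4 * a' ^ 3 + 27 * b' ^ 2)"
    using W by blast
next
  fix j assume "\<exists>a' b'. has_weierstrass_equation \<iota> E a' b' \<and>
      j = 1728 * (4 * a' ^ 3) / (4 * a' ^ 3 + 27 * b' ^ 2)"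
  then obtain a' b' where W': "has_weierstrass_equation \<iota> E a' b'"
      and j: "j = 1728 * (4 * a' ^ 3) / (4 * a' ^ 3 + 27 * b' ^ 2)" by blast
  have ev: "t ^ 3 + \<iota> a * t + \<iota> b = ev t [:b, a, 0, 1:]" for t a b
    by (simp add: algebra_simps power3_eq_cube)
  obtain x y where ns: "4 * a ^ 3 + 27 * b ^ 2 \<noteq> 0" and x: "transcendental_over \<iota> x"
      and y: "y ^ 2 = ev x [:b, a, 0, 1:]" and E: "E = adjoin \<iota> {x, y}"
    using W unfolding has_weierstrass_equation_def ev by blast
  obtain x' y' where ns': "4 * a' ^ 3 + 27 * b' ^ 2 \<noteq> 0" and x': "transcendental_over \<iota> x'"
      and y': "y' ^ 2 = ev x' [:b', a', 0, 1:]" and E': "E = adjoin \<iota> {x', y'}"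
    using W' unfolding has_weierstrass_equation_def ev by blast
  have gen: "adjoin \<iota> {x, y} = adjoin \<iota> {x', y'}" using E E' by simp
  have sq: "y ^ 2 \<in> adjoin \<iota> {x}" "y' ^ 2 \<in> adjoin \<iota> {x'}"
    unfolding y y' by (rule ev_in_adjoin, rule adjoin_gen, simp)+
  have notin: "y \<notin> adjoin \<iota> {x}" "y' \<notin> adjoin \<iota> {x'}"
    using notin_adjoin_of_odd_degree[OF x y] notin_adjoin_of_odd_degree[OF x' y'] by auto
  \<comment> \<open>Either both memberships hold, which is the Moebius case, or both fail, which is
    the generic case.\<close>
  have "x \<in> adjoin \<iota> {x'} \<longleftrightarrow> x' \<in> adjoin \<iota> {x}"
    using mem_adjoin_singleton_swap[OF gen sq(1) notin(2)]
      mem_adjoin_singleton_swap[OF gen[symmetric] sq(2) notin(1)] by blast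
  then obtain c d where "c \<noteq> 0" "d \<noteq> 0" "c ^ 2 * a = d ^ 2 * a'" "c ^ 3 * b = d ^ 3 * b'"
    using weierstrass_scaling_generic[OF x y x' y' ns ns' gen]
      weierstrass_scaling_moebius[OF x y x' y' ns gen] by metis
  then show "j = 1728 * (4 * a ^ 3) / (4 * a ^ 3 + 27 * b ^ 2)"
    unfolding j using j_eq_of_scaling by metis
qed

section \<open>Changes of coordinate and reduction of a monic cubic to short Weierstrass
  form\<close>

lemma transcendental_ev:
  assumes "transcendental_over \<iota> x" "degree q > 0"
  shows "transcendental_over \<iota> (ev x q)"
  using assms by (auto simp: transcendental_iff pcompose_eq_0 simp flip: ev_pcompose)

text \<open>A polynomial relation for \<open>inverse x\<close> becomes one for \<open>x\<close> on
  multiplying by \<open>x ^ degree p\<close>, which reverses the coefficients.\<close>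

lemma transcendental_inverse:
  assumes x: "transcendental_over \<iota> x"
  shows "transcendental_over \<iota> (inverse x)"
  unfolding transcendental_iff
proof (intro allI impI)
  fix p assume p: "ev (inverse x) p = 0"
  have "ev x [:0, 1:] \<noteq> 0"
    using x unfolding transcendental_iff by (metis pCons_eq_0_iff zero_neq_one)
  then have "x \<noteq> 0" by simp
  have "map_poly \<iota> (reflect_poly p) = reflect_poly (map_poly \<iota> p)"
    by (simp add: poly_eq_iff coeff_map_poly coeff_reflect_poly)
  then have "ev x (reflect_poly p) = x ^ degree p * ev (inverse x) p"
    using \<open>x \<noteq> 0\<close> by (simp add: ev_def poly_reflect_poly_nz)
  then have "ev x (reflect_poly p) = 0" using p by simp
  then have "reflect_poly p = 0"
    using x unfolding transcendental_iff by blast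
  then show "p = 0" by simp
qed

text \<open>The translation \<open>t = x + c2 / 3\<close> removes the quadratic term and generates
  the same field.\<close>

lemma has_weierstrass_equation_of_cubic:
  assumes x: "transcendental_over \<iota> x"
    and y: "y ^ 2 = x ^ 3 + \<iota> c2 * x ^ 2 + \<iota> c1 * x + \<iota> c0"
    and E: "E = adjoin \<iota> {x, y}"
    and a: "a = (3 * c1 - c2 ^ 2) / 3" and b: "b = (2 * c2 ^ 3 - 9 * c1 * c2 + 27 * c0) / 27"
    and ns: "4 * a ^ 3 + 27 * b ^ 2 \<noteq> 0"
  shows "has_weierstrass_equation \<iota> E a b"
  unfolding has_weierstrass_equation_def
proof (intro conjI exI)
  define e where "e = c2 / 3"
  define t where "t = x + \<iota> e"
  have c: "c2 = 3 * e" "c1 = a + 3 * e ^ 2" "c0 = b + e * a + e ^ 3"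
    by (simp_all add: e_def a b field_simps power2_eq_square power3_eq_cube)
  show "4 * a ^ 3 + 27 * b ^ 2 \<noteq> 0" by fact
  show "transcendental_over \<iota> t"
    using transcendental_ev[OF x, of "[:e, 1:]"] by (simp add: t_def add.commute)
  show "y ^ 2 = t ^ 3 + \<iota> a * t + \<iota> b"
    unfolding y c t_def hom_add hom_mult hom_power hom_numeral
    by (simp add: algebra_simps power2_eq_square power3_eq_cube)
  have "x = t - \<iota> e" by (simp add: t_def)
  also have "\<dots> \<in> adjoin \<iota> {t, y}"
    by (intro adjoin_closed adjoin_scalar adjoin_gen) simp
  finally have "x \<in> adjoin \<iota> {t, y}" .
  moreover have "t \<in> adjoin \<iota> {x, y}"
    unfolding t_def by (intro adjoin_closed adjoin_scalar adjoin_gen) simp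
  moreover have "y \<in> adjoin \<iota> {x, y}" "y \<in> adjoin \<iota> {t, y}"
    by (simp_all add: adjoin_gen)
  ultimately show "E = adjoin \<iota> {t, y}"
    unfolding E by (intro adjoin_eqI) auto
qed

end

section \<open>The two cubic models and the quadratic satisfied by their j-invariants\<close>

lemma proots_monic_quadratic:
  "proots [:j * j', - (j + j'), 1:] = {#j, j'#}" for j :: "'a::idom"
proof -
  have "[:j * j', - (j + j'), 1:] = [:- j, 1:] * [:- j', 1:]"
    by (simp add: algebra_simps)
  then show ?thesis
    by (simp only: proots_mult[of "[:- j, 1:]" "[:- j', 1:]"] pCons_eq_0_iff one_neq_zero simp_thms)
      simp
qed

text \<open>The right side is minus the discriminant of \<open>x^3 + c2 x^2 + c1 x + c0\<close>,
  which the translation to short form leaves unchanged.\<close>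

lemma short_weierstrass_discriminant:
  fixes c0 c1 c2 :: "'k::field_char_0"
  shows "4 * ((3 * c1 - c2 ^ 2) / 3) ^ 3 + 27 * ((2 * c2 ^ 3 - 9 * c1 * c2 + 27 * c0) / 27) ^ 2
      = 4 * c1 ^ 3 - c1 ^ 2 * c2 ^ 2 - 18 * c0 * c1 * c2 + 4 * c0 * c2 ^ 3 + 27 * c0 ^ 2"
    (is "_ = ?R")
proof -
  have split: "4 * (A / 3) ^ 3 + 27 * (B / 27) ^ 2 = (4 * A ^ 3 + B ^ 2) / 27" for A B :: 'k
    by (simp add: power_divide add_divide_distrib)
  have "4 * (3 * c1 - c2 ^ 2) ^ 3 + (2 * c2 ^ 3 - 9 * c1 * c2 + 27 * c0) ^ 2 = 27 * ?R"
    by (simp add: algebra_simps power2_eq_square power3_eq_cube)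
  then show ?thesis
    unfolding split by (simp only:) (rule nonzero_mult_div_cancel_left, simp)
qed

text \<open>\<open>(X Y)^2\<close> is a quartic in \<open>X^2\<close> with a root at 0. The
  substitution by \<open>- 1 / w\<close> sends that root to infinity and leaves a cubic in
  \<open>w\<close>.\<close>

lemma cubic_at_neg_inverse:
  fixes w :: "'k::field"
  assumes w: "w \<noteq> 0"
  shows "- inverse w * ((- inverse w) ^ 3 - s1 * (- inverse w) ^ 2 + s2 * (- inverse w) - 1) * w ^ 4
    = w ^ 3 + s2 * w ^ 2 + s1 * w + 1"
proof -
  have "- i * ((- i) ^ 3 - s1 * (- i) ^ 2 + s2 * (- i) - 1) * w ^ 4
      = (i * w) ^ 4 + s1 * (i * w) ^ 3 * w + s2 * (i * w) ^ 2 * w ^ 2 + (i * w) * w ^ 3" for i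
    by (simp add: power2_eq_square power3_eq_cube power4_eq_xxxx algebra_simps)
  from this[of "inverse w"] show ?thesis using w by simp
qed

theorem mainTheorem2:
  fixes \<iota> :: "'k::{alg_closed_field, field_char_0} \<Rightarrow> 'K::field"
    and s\<^sub>1 s\<^sub>2 u v j\<^sub>1 j\<^sub>2 :: 'k
    and X Y :: 'K
    and E\<^sub>1 E\<^sub>2 :: "'K set"
  assumes hom: "field_hom \<iota>"
    and nondegenerate: "27 - 18 * s\<^sub>1 * s\<^sub>2 - s\<^sub>1 ^ 2 * s\<^sub>2 ^ 2 + 4 * s\<^sub>1 ^ 3 + 4 * s\<^sub>2 ^ 3 \<noteq> 0"
    and X_transcendental: "transcendental_over \<iota> X"
    and equation: "Y ^ 2 = X ^ 6 - \<iota> s\<^sub>1 * X ^ 4 + \<iota> s\<^sub>2 * X ^ 2 - 1"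
    and generated: "adjoin \<iota> {X, Y} = (UNIV :: 'K set)"
    and u: "u = s\<^sub>1 * s\<^sub>2" and v: "v = s\<^sub>1 ^ 3 + s\<^sub>2 ^ 3"
    and E\<^sub>1: "E\<^sub>1 = adjoin \<iota> {X ^ 2, Y}" and E\<^sub>2: "E\<^sub>2 = adjoin \<iota> {X ^ 2, X * Y}"
    and j\<^sub>1: "j\<^sub>1 = j_invariant \<iota> E\<^sub>1" and j\<^sub>2: "j\<^sub>2 = j_invariant \<iota> E\<^sub>2"
  shows "proots
           [: 65536 * ((u ^ 2 + 9 * u - 3 * v) ^ 3 / (u ^ 2 + 18 * u - 4 * v - 27) ^ 2),
              256 * ((2 * u ^ 3 - 54 * u ^ 2 + 9 * u * v - v ^ 2 + 27 * v)
                       / (u ^ 2 + 18 * u - 4 * v - 27)),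
              1 :] = {# j\<^sub>1, j\<^sub>2 #}"
proof -
  interpret field_extension \<iota>
    using hom by (simp add: field_extension_def)
  define D where "D = 27 - 18 * s\<^sub>1 * s\<^sub>2 - s\<^sub>1 ^ 2 * s\<^sub>2 ^ 2 + 4 * s\<^sub>1 ^ 3 + 4 * s\<^sub>2 ^ 3"
  define g\<^sub>1 where "g\<^sub>1 = 3 * s\<^sub>2 - s\<^sub>1 ^ 2"
  define g\<^sub>2 where "g\<^sub>2 = 3 * s\<^sub>1 - s\<^sub>2 ^ 2"
  have D: "D \<noteq> 0" using nondegenerate by (simp add: D_def)
  \<comment> \<open>Both cubic models have minus discriminant equal to \<open>D\<close>, and
    \<open>1728 * 4 / 27 = 256\<close>.\<close>
  have j: "j_invariant \<iota> E = 256 * (3 * c1 - c2 ^ 2) ^ 3 / D"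
    if "transcendental_over \<iota> x" "y ^ 2 = x ^ 3 + \<iota> c2 * x ^ 2 + \<iota> c1 * x + \<iota> c0"
      "E = adjoin \<iota> {x, y}"
      "4 * c1 ^ 3 - c1 ^ 2 * c2 ^ 2 - 18 * c0 * c1 * c2 + 4 * c0 * c2 ^ 3 + 27 * c0 ^ 2 = D"
    for E x y c0 c1 c2
  proof -
    let ?a = "(3 * c1 - c2 ^ 2) / 3" and ?b = "(2 * c2 ^ 3 - 9 * c1 * c2 + 27 * c0) / 27"
    have disc': "4 * ?a ^ 3 + 27 * ?b ^ 2 = D"
      using short_weierstrass_discriminant[of c1 c2 c0] that(4) by simp
    have "j_invariant \<iota> E = 1728 * (4 * ?a ^ 3) / (4 * ?a ^ 3 + 27 * ?b ^ 2)"
      using disc' D by (intro j_invariant_eqI has_weierstrass_equation_of_cubic[OF that(1-3) refl refl]) simp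
    also have "\<dots> = 256 * (3 * c1 - c2 ^ 2) ^ 3 / D"
      unfolding disc' by (simp add: power_divide)
    finally show ?thesis .
  qed
  have "X \<noteq> 0"
    using X_transcendental unfolding transcendental_iff by (metis ev.hom_zero ev_pCons hom_one hom_zero add_0 mult_zero_left pCons_eq_0_iff zero_neq_one)
  have X2: "transcendental_over \<iota> (X ^ 2)"
    using transcendental_ev[OF X_transcendental, of "[:0, 0, 1:]"] by (simp add: power2_eq_square)
  have j1: "j\<^sub>1 = 256 * g\<^sub>1 ^ 3 / D"
  proof -
    have "Y ^ 2 = (X ^ 2) ^ 3 + \<iota> (- s\<^sub>1) * (X ^ 2) ^ 2 + \<iota> s\<^sub>2 * X ^ 2 + \<iota> (- 1)"
      unfolding equation by (simp add: hom_uminus flip: power_mult)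
    from j[OF X2 this E\<^sub>1] show ?thesis
      unfolding j\<^sub>1 g\<^sub>1_def D_def by (simp add: algebra_simps)
  qed
  \<comment> \<open>Inverting \<open>X\<^sup>2\<close> swaps the roles of \<open>s\<^sub>1\<close> and \<open>s\<^sub>2\<close>.\<close>
  have j2: "j\<^sub>2 = 256 * g\<^sub>2 ^ 3 / D"
  proof -
    \<comment> \<open>The minus sign makes the resulting cubic monic, and the factor
      \<open>w ^ 2\<close> in \<open>z\<close> supplies the \<open>w ^ 4\<close> that clears
      denominators.\<close>
    define w where "w = - inverse (X ^ 2)"
    define z where "z = X * Y * w ^ 2"
    have w: "w \<noteq> 0" "X ^ 2 = - inverse w" using \<open>X \<noteq> 0\<close> by (auto simp: w_def)
    have "transcendental_over \<iota> w"
      using transcendental_ev[OF transcendental_inverse[OF X2], of "[:0, - 1:]"]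
      by (simp add: w_def hom_uminus)
    moreover have "z ^ 2 = w ^ 3 + \<iota> s\<^sub>2 * w ^ 2 + \<iota> s\<^sub>1 * w + \<iota> 1"
    proof -
      have "z ^ 2 = X ^ 2 * ((X ^ 2) ^ 3 - \<iota> s\<^sub>1 * (X ^ 2) ^ 2 + \<iota> s\<^sub>2 * X ^ 2 - 1) * w ^ 4"
        unfolding z_def power_mult_distrib equation by (simp flip: power_mult)
      also have "\<dots> = w ^ 3 + \<iota> s\<^sub>2 * w ^ 2 + \<iota> s\<^sub>1 * w + \<iota> 1"
        unfolding w(2) cubic_at_neg_inverse[OF w(1)] by simp
      finally show ?thesis .
    qed
    moreover have "E\<^sub>2 = adjoin \<iota> {w, z}"
    proof -
      have "X ^ 2 = (- 1) / w" "X * Y = z / w ^ 2"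
        using w by (simp_all add: z_def inverse_eq_divide)
      moreover have "(- 1) / w \<in> adjoin \<iota> {w, z}" "z / w ^ 2 \<in> adjoin \<iota> {w, z}"
        by (intro adjoin_closed adjoin_gen; simp)+
      moreover have "w = (- 1) / X ^ 2" by (simp add: w_def inverse_eq_divide)
      then have wE: "w \<in> adjoin \<iota> {X ^ 2, X * Y}"
        by (simp only: adjoin_closed adjoin_gen insertI1)
      have "X * Y \<in> adjoin \<iota> {X ^ 2, X * Y}" by (intro adjoin_gen) simp
      then have "z \<in> adjoin \<iota> {X ^ 2, X * Y}"
        unfolding z_def by (rule adjoin_closed(4)[OF _ adjoin_closed(8)[OF wE]])
      ultimately show ?thesis
        unfolding E\<^sub>2 using wE by (intro adjoin_eqI) auto
    qed
    ultimately show ?thesis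
      using j[of w z s\<^sub>2 s\<^sub>1 1 E\<^sub>2] unfolding j\<^sub>2 g\<^sub>2_def D_def by (simp add: algebra_simps)
  qed
  \<comment> \<open>By Vieta it remains to match \<open>j\<^sub>1 * j\<^sub>2\<close>, which is
    \<open>256 ^ 2\<close> times the cube of \<open>g\<^sub>1 * g\<^sub>2\<close> over
    \<open>D ^ 2\<close>, and \<open>j\<^sub>1 + j\<^sub>2\<close>. The denominator in the statement
    is \<open>- D\<close>, which accounts for the sign of the linear coefficient.\<close>
  have D': "u ^ 2 + 18 * u - 4 * v - 27 = - D"
    by (simp add: D_def u v algebra_simps)
  have "u ^ 2 + 9 * u - 3 * v = g\<^sub>1 * g\<^sub>2"
    by (simp add: g\<^sub>1_def g\<^sub>2_def u v algebra_simps power2_eq_square power3_eq_cube)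
  then have "65536 * ((u ^ 2 + 9 * u - 3 * v) ^ 3 / (u ^ 2 + 18 * u - 4 * v - 27) ^ 2) = j\<^sub>1 * j\<^sub>2"
    unfolding D' j1 j2 using D by (simp add: power_mult_distrib power2_eq_square)
  moreover have "2 * u ^ 3 - 54 * u ^ 2 + 9 * u * v - v ^ 2 + 27 * v = g\<^sub>1 ^ 3 + g\<^sub>2 ^ 3"
    by (simp add: g\<^sub>1_def g\<^sub>2_def u v algebra_simps power2_eq_square power3_eq_cube)
  then have "256 * ((2 * u ^ 3 - 54 * u ^ 2 + 9 * u * v - v ^ 2 + 27 * v)
      / (u ^ 2 + 18 * u - 4 * v - 27)) = - (j\<^sub>1 + j\<^sub>2)"
    unfolding D' j1 j2 by (simp add: add_divide_distrib)
  ultimately show ?thesis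
    by (simp only: proots_monic_quadratic)
qed

end
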